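(* Let $\mathcal C(\mathbb Z[X])$ be the set of polynomials $f\in\mathbb Z[X]$ with $f=0$ or $f>0$, where $\mathbb Z[X]$ is ordered by declaring a nonzero polynomial positive iff its leading coefficient is positive, viewed as a structure for $\{+,\cdot,0,1,<\}$. Then $\mathcal C(\mathbb Z[X])$ satisfies $\mathbf{GS}^s$: for every prime $p$ there exists $n$ such that $n$ is $p$-good and no $m$ with $n<m$ is $p$-good.
   Context: In a structure for $\{+,\cdot,0,1,<\}$: $x\mid y$ means $\exists z\,(xz=y)$; $m,n$ are relatively prime if every common divisor of $m$ and $n$ equals $1$; $x$ is prime means $1<x$ and for all $a,b,c$, if $xc=ab$ then $x\mid a$ or $x\mid b$. For a prime $p$, an element $n$ is $p$-good if every $t$ with $1<t<n$, $t$ relatively prime to $n$, and $v$ relatively prime to $t$ for every prime $v\le p$, is prime. *)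

theory Defs
  imports "HOL-Computational_Algebra.Polynomial"
begin

text \<open>
  A structure for the language $\{+,\cdot,0,1,<\}$ is given by a carrier set \<open>M\<close> together with
  the operations and the order of its ambient type. All quantifiers of the formulas below range
  over \<open>M\<close>; in particular divisibility is divisibility inside \<open>M\<close>, and primality is the
  first-order notion of the structure, not the library predicate on the ambient ring.
\<close>

definition divides_in :: "'a::{zero,one,plus,times,order} set \<Rightarrow> 'a \<Rightarrow> 'a \<Rightarrow> bool" where
  "divides_in M x y \<longleftrightarrow> (\<exists>z\<in>M. x * z = y)"

definition rel_prime_in :: "'a::{zero,one,plus,times,order} set \<Rightarrow> 'a \<Rightarrow> 'a \<Rightarrow> bool" where
  "rel_prime_in M m n \<longleftrightarrow> (\<forall>d\<in>M. divides_in M d m \<and> divides_in M d n \<longrightarrow> d = 1)"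

definition prime_in :: "'a::{zero,one,plus,times,order} set \<Rightarrow> 'a \<Rightarrow> bool" where
  "prime_in M x \<longleftrightarrow>
     1 < x \<and> (\<forall>a\<in>M. \<forall>b\<in>M. \<forall>c\<in>M. x * c = a * b \<longrightarrow> divides_in M x a \<or> divides_in M x b)"

definition good_in :: "'a::{zero,one,plus,times,order} set \<Rightarrow> 'a \<Rightarrow> 'a \<Rightarrow> bool" where
  "good_in M p n \<longleftrightarrow>
     (\<forall>t\<in>M. 1 < t \<and> t < n \<and> rel_prime_in M t n \<and>
              (\<forall>v\<in>M. prime_in M v \<and> v \<le> p \<longrightarrow> rel_prime_in M v t)
            \<longrightarrow> prime_in M t)"

definition satisfies_GSs :: "'a::{zero,one,plus,times,order} set \<Rightarrow> bool" where
  "satisfies_GSs M \<longleftrightarrow>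
     (\<forall>p\<in>M. prime_in M p \<longrightarrow>
        (\<exists>n\<in>M. good_in M p n \<and> \<not> (\<exists>m\<in>M. n < m \<and> good_in M p m)))"

definition C_ZX :: "int poly set" where
  "C_ZX = {f. f = 0 \<or> 0 < f}"

lemma C_ZX_closed:
  "0 \<in> C_ZX" "1 \<in> C_ZX"
  "f \<in> C_ZX \<Longrightarrow> g \<in> C_ZX \<Longrightarrow> f + g \<in> C_ZX"
  "f \<in> C_ZX \<Longrightarrow> g \<in> C_ZX \<Longrightarrow> f * g \<in> C_ZX"
  by (auto simp: C_ZX_def add_pos_pos)

text \<open>
  The library orders polynomials over an ordered domain by the sign of the leading coefficient.
\<close>

lemma poly_pos_iff_lead_coeff:
  fixes f :: "'a::linordered_idom poly"
  shows "0 < f \<longleftrightarrow> f \<noteq> 0 \<and> 0 < lead_coeff f"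
  by (cases "f = 0") (simp_all add: less_poly_def pos_poly_def last_coeffs_eq_coeff_degree)

lemma poly_less_iff_lead_coeff:
  fixes f g :: "'a::linordered_idom poly"
  shows "f < g \<longleftrightarrow> f \<noteq> g \<and> 0 < lead_coeff (g - f)"
  using poly_pos_iff_lead_coeff[of "g - f"] by auto

end

theory Submission
  imports Defs "HOL-Computational_Algebra.Computational_Algebra"
begin

text \<open>
  If \<open>m\<close> is \<open>p\<close>-good, then every prime \<open>q > p\<close> with \<open>q\<^sup>2 < m\<close> divides \<open>m\<close>. For constant \<open>p\<close> this
  excludes every nonconstant \<open>m\<close>, which would be divisible by almost all integer primes, and it
  bounds the constant \<open>m\<close>. For nonconstant \<open>p\<close> the order is not a well-order and a bound
  does not yield a maximum. Here infinitely many constant translates \<open>p + c\<close> are prime; if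
  \<open>q\<^sub>1 < q\<^sub>2\<close> are the least two above \<open>p\<close> and \<open>d = q\<^sub>2 - q\<^sub>1\<close>, the maximum is \<open>q\<^sub>1 (q\<^sub>1 + 2 d)\<close>: a larger
  \<open>p\<close>-good \<open>m\<close> is divisible by \<open>q\<^sub>1\<close>, hence exceeds \<open>q\<^sub>2\<^sup>2\<close>, hence is a multiple of \<open>q\<^sub>1 q\<^sub>2\<close>
  of at least twice its size, and is then divisible by all primes \<open>p + c\<close> with \<open>c > 0\<close>.
\<close>

section \<open>Counting primes, and integers divisible by all their medium-sized primes\<close>

text \<open>
  Erdos's count: each \<open>m \<le> x\<close> is determined by its square part, at most \<open>\<surd>x\<close>, and the set of
  primes dividing its squarefree part.
\<close>

lemma le_4_pow_card_primes:
  fixes x :: nat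
  assumes "0 < x"
  shows "x \<le> 4 ^ card {q. prime q \<and> q \<le> x}"
proof -
  define S where "S = {q. prime q \<and> q \<le> x}"
  define R where "R = {r. 0 < r \<and> r\<^sup>2 \<le> x}"
  have S: "finite S" unfolding S_def by simp
  have R_sub: "R \<subseteq> {1..x}"
    by (auto simp: R_def) (metis order.trans power2_nat_le_imp_le)
  then have R: "finite R" by (rule finite_subset) simp
  have "R \<noteq> {}" using assms by (auto simp: R_def intro: exI[of _ 1])
  define s where "s = Max R"
  have s: "s\<^sup>2 \<le> x" using Max_in[OF R \<open>R \<noteq> {}\<close>] unfolding R_def s_def by blast
  have "R \<subseteq> {1..s}" using R_sub R by (auto simp: s_def)
  then have card_R: "card R \<le> s" using card_mono[of "{1..s}" R] by simp
  define f where "f = (\<lambda>m::nat. (square_part m, prime_factors (squarefree_part m)))"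
  have "inj_on f {1..x}"
  proof (rule inj_onI)
    fix a b :: nat
    assume ab: "a \<in> {1..x}" "b \<in> {1..x}" and eq: "f a = f b"
    have sq: "square_part a = square_part b"
      and pf: "prime_factors (squarefree_part a) = prime_factors (squarefree_part b)"
      using eq by (auto simp: f_def)
    \<comment> \<open>Every exponent in a squarefree part is 1, so the set of its prime factors
      determines it.\<close>
    have "squarefree_part m = \<Prod>(prime_factors (squarefree_part m))" for m :: nat
    proof -
      have "squarefree_part m = (\<Prod>p\<in>prime_factors (squarefree_part m). p ^ multiplicity p (squarefree_part m))"
        using prod_prime_factors[of "squarefree_part m"] by simp
      also have "\<dots> = \<Prod>(prime_factors (squarefree_part m))"
      proof (rule prod.cong[OF refl])
        fix p assume p: "p \<in> prime_factors (squarefree_part m)"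
        then have "multiplicity p (squarefree_part m) > 0"
          by (simp add: prime_factors_multiplicity)
        moreover have "multiplicity p (squarefree_part m) \<le> 1"
          using prime_multiplicity_squarefree_part_le_Suc_0[of p m] p by auto
        ultimately have "multiplicity p (squarefree_part m) = 1" by linarith
        then show "p ^ multiplicity p (squarefree_part m) = p" by simp
      qed
      finally show ?thesis .
    qed
    then have "squarefree_part a = squarefree_part b" using pf by metis
    then show "a = b" using sq squarefree_decompose[of a] squarefree_decompose[of b] by metis
  qed
  moreover have "f ` {1..x} \<subseteq> R \<times> Pow S"
  proof
    fix y assume "y \<in> f ` {1..x}"
    then obtain m where m: "0 < m" "m \<le> x" and y: "y = f m"
      by (metis Suc_le_eq One_nat_def atLeastAtMost_iff imageE)
    have "square_part m ^ 2 \<le> m" using m(1) by (rule dvd_imp_le[OF square_part_square_dvd])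
    moreover have "0 < square_part m" using m by (intro gr0I) simp
    moreover have "q \<le> x" if "q \<in> prime_factors (squarefree_part m)" for q
    proof -
      have "q dvd m"
        using that dvdI[OF squarefree_decompose[of m]] by (blast intro: dvd_trans)
      then show ?thesis using m dvd_imp_le[of q m] by linarith
    qed
    ultimately show "y \<in> R \<times> Pow S" using y m by (auto simp: f_def R_def S_def)
  qed
  ultimately have "card {1..x} \<le> card (R \<times> Pow S)"
    using R S by (intro card_inj_on_le) auto
  then have "x \<le> card R * 2 ^ card S" using S by (simp add: card_cartesian_product card_Pow)
  also have "\<dots> \<le> s * 2 ^ card S" using card_R by simp
  \<comment> \<open>Squaring replaces the square root by \<open>s\<^sup>2 \<le> x\<close>, after
    which one factor \<open>x\<close> cancels.\<close>
  finally have "x\<^sup>2 \<le> (s * 2 ^ card S)\<^sup>2" by (rule power_mono) simp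
  also have "\<dots> = s\<^sup>2 * 4 ^ card S"
    by (simp add: power_mult_distrib power2_eq_square flip: power_mult_distrib)
  also have "\<dots> \<le> x * 4 ^ card S" using s by simp
  finally show ?thesis using assms by (simp add: power2_eq_square S_def)
qed

text \<open>The maximum of \<open>k\<close> positive naturals is at least \<open>k\<close>; removing
  it gives the induction.\<close>

lemma fact_card_le_prod:
  fixes A :: "nat set"
  assumes "finite A" "0 \<notin> A"
  shows "fact (card A) \<le> \<Prod>A"
  using assms
proof (induction "card A" arbitrary: A)
  case (Suc k)
  then have ne: "A \<noteq> {}" by auto
  let ?m = "Max A"
  have m: "?m \<in> A" using Suc ne by simp
  have "A \<subseteq> {1..?m}" using Suc by (auto simp: Suc_le_eq intro: gr0I)
  then have "card A \<le> ?m" using card_mono[of "{1..?m}" A] by simp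
  moreover have "fact (card (A - {?m})) \<le> \<Prod>(A - {?m})"
    using Suc m by (intro Suc(1)) auto
  moreover have "fact (card A) = card A * fact (card (A - {?m}))"
    using Suc m by (metis card_Suc_Diff1 fact_Suc of_nat_id)
  ultimately show ?case
    using Suc m by (simp add: prod.remove[of A ?m] mult_le_mono)
qed simp

lemma prod_primes_dvd:
  fixes n :: nat
  assumes "finite A" "\<And>q. q \<in> A \<Longrightarrow> prime q" "\<And>q. q \<in> A \<Longrightarrow> q dvd n"
  shows "\<Prod>A dvd n"
  using assms
proof (induction A rule: finite_induct)
  case (insert a A)
  have "coprime a (\<Prod>A)"
    using insert by (intro prod_coprime_right) (metis insertCI primes_coprime)
  then show ?case using insert by (simp add: divides_mult)
qed simp

text \<open>The terms of the exponential series at 16 tend to 0. The base 16 is the square of the 4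
  in the prime count.\<close>

lemma ex_fact_gt_exponential:
  fixes C :: nat
  shows "\<exists>k0. \<forall>k\<ge>k0. C * 16 ^ k < fact k"
proof -
  have "(\<lambda>k. inverse (fact k) * (16::real) ^ k) \<longlonglongrightarrow> 0"
    by (rule summable_LIMSEQ_zero[OF summable_exp])
  \<comment> \<open>\<open>Suc C\<close> keeps the bound positive when \<open>C = 0\<close>.\<close>
  then have "\<forall>\<^sub>F k in sequentially. inverse (fact k) * (16::real) ^ k < 1 / real (Suc C)"
    by (rule order_tendstoD) simp
  then obtain k0 where k0: "\<And>k. k \<ge> k0 \<Longrightarrow> inverse (fact k) * (16::real) ^ k < 1 / real (Suc C)"
    by (auto simp: eventually_sequentially)
  have "C * 16 ^ k < fact k" if "k \<ge> k0" for k
  proof -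
    have "real (Suc C) * 16 ^ k < fact k"
      using k0[OF that] by (simp add: field_simps)
    then have "real (Suc C * 16 ^ k) < real (fact k)" by (simp only: of_nat_mult of_nat_power of_nat_numeral of_nat_fact)
    then have "Suc C * 16 ^ k < (fact k :: nat)" by (simp only: of_nat_less_iff)
    then show ?thesis by (simp add: add_lessD1)
  qed
  then show ?thesis by blast
qed

text \<open>
  Bonse-type bound: the primes in \<open>(P, \<surd>N)\<close> are so numerous that they cannot all divide \<open>N\<close>.
\<close>

lemma bounded_if_small_primes_dvd:
  fixes P :: nat
  shows "\<exists>B. \<forall>N. (\<forall>q. prime q \<longrightarrow> P < q \<longrightarrow> q\<^sup>2 < N \<longrightarrow> q dvd N) \<longrightarrow> N \<le> B"
proof -
  obtain k0 where k0: "\<And>k. k \<ge> k0 \<Longrightarrow> (4 * 16 ^ P) * 16 ^ k < (fact k :: nat)"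
    using ex_fact_gt_exponential[of "4 * 16 ^ P"] by blast
  have "N \<le> 4 * 16 ^ (P + k0)"
    if N: "\<And>q. prime q \<Longrightarrow> P < q \<Longrightarrow> q\<^sup>2 < N \<Longrightarrow> q dvd N" for N :: nat
  proof (cases "N \<le> 1")
    case True
    have "1 \<le> 4 * (16::nat) ^ (P + k0)" by simp
    then show ?thesis using True by linarith
  next
    case False
    define X where "X = {x. x\<^sup>2 < N}"
    have "X \<subseteq> {..N}" by (auto simp: X_def) (meson less_imp_le order.trans power2_nat_le_imp_le)
    then have X: "finite X" by (rule finite_subset) simp
    have "1 \<in> X" using False by (simp add: X_def)
    \<comment> \<open>The largest \<open>x\<close> with \<open>x\<^sup>2 < N\<close>; maximality
      gives \<open>N \<le> (x + 1)\<^sup>2\<close>, so \<open>N\<close> is at most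
      \<open>4 * x\<^sup>2\<close>.\<close>
    define x where "x = Max X"
    have x: "x\<^sup>2 < N" using Max_in[OF X] \<open>1 \<in> X\<close> unfolding x_def X_def by blast
    have "1 \<le> x" using X \<open>1 \<in> X\<close> by (simp add: x_def)
    have "Suc x \<notin> X" using Max_ge[OF X, of "Suc x"] by (auto simp: x_def)
    then have "N \<le> (Suc x)\<^sup>2" by (simp add: X_def)
    also have "\<dots> \<le> (2 * x)\<^sup>2" using \<open>1 \<le> x\<close> by (intro power_mono) auto
    also have "\<dots> = 4 * x\<^sup>2" by (simp add: power2_eq_square)
    finally have Nx: "N \<le> 4 * x\<^sup>2" .
    define K where "K = {q. prime q \<and> P < q \<and> q \<le> x}"
    have K: "finite K" unfolding K_def by simp
    have "{q. prime q \<and> q \<le> x} \<subseteq> {1..P} \<union> K"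
      by (auto simp: K_def Suc_le_eq prime_gt_0_nat)
    then have "card {q. prime q \<and> q \<le> x} \<le> card ({1..P} \<union> K)"
      using K by (intro card_mono) auto
    also have "\<dots> \<le> P + card K" using card_Un_le[of "{1..P}" K] by simp
    finally have "(4::nat) ^ card {q. prime q \<and> q \<le> x} \<le> 4 ^ (P + card K)" by simp
    then have "x \<le> 4 ^ (P + card K)" using le_4_pow_card_primes[of x] \<open>1 \<le> x\<close> by linarith
    then have "x\<^sup>2 \<le> (4 ^ (P + card K))\<^sup>2" by (rule power_mono) simp
    also have "\<dots> = 16 ^ (P + card K)" by (simp add: power2_eq_square flip: power_mult_distrib)
    finally have NK: "N \<le> 4 * 16 ^ (P + card K)" using Nx by linarith
    have "\<Prod>K dvd N"
    proof (rule prod_primes_dvd[OF K])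
      fix q assume "q \<in> K"
      then have q: "prime q" "P < q" "q \<le> x" by (auto simp: K_def)
      then have "q\<^sup>2 \<le> x\<^sup>2" by (intro power_mono) auto
      then show "q dvd N" using N[OF q(1,2)] x by linarith
    qed (simp add: K_def)
    then have "\<Prod>K \<le> N" using False by (intro dvd_imp_le) auto
    moreover have "fact (card K) \<le> \<Prod>K" using K by (intro fact_card_le_prod) (auto simp: K_def)
    \<comment> \<open>\<open>N\<close> is at most exponential in \<open>card K\<close>, yet at least
      \<open>fact (card K)\<close>; this bounds \<open>card K\<close>, and then
      \<open>N\<close>.\<close>
    ultimately have "\<not> (4 * 16 ^ P) * 16 ^ card K < (fact (card K) :: nat)"
      using NK by (simp add: power_add)
    then have "card K \<le> k0" using k0 by (meson linorder_le_cases)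
    then have "(16::nat) ^ (P + card K) \<le> 16 ^ (P + k0)" by (intro power_increasing) auto
    then show ?thesis using NK by linarith
  qed
  then show ?thesis by blast
qed

section \<open>Complex roots and an irreducibility criterion\<close>

text \<open>Up to sign, the constant term is the leading coefficient times the product of the roots;
  the induction splits off one root at a time.\<close>

lemma norm_lead_coeff_le_coeff_0:
  fixes g :: "complex poly"
  assumes "\<And>z. poly g z = 0 \<Longrightarrow> 1 < norm z"
  shows "norm (lead_coeff g) \<le> norm (coeff g 0) \<and>
    (0 < degree g \<longrightarrow> norm (lead_coeff g) < norm (coeff g 0))"
  using assms
proof (induction "degree g" arbitrary: g)
  case (Suc n)
  have "\<not> constant (poly g)" using Suc by (simp add: constant_degree)
  then obtain z where z: "poly g z = 0" using fundamental_theorem_of_algebra by blast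
  then obtain h where h: "g = [:-z, 1:] * h" by (metis dvd_def poly_eq_0_iff_dvd)
  have "g \<noteq> 0" using Suc by auto
  then have "h \<noteq> 0" using h by auto
  then have "degree g = Suc (degree h)" unfolding h by (subst degree_mult_eq) auto
  then have "norm (lead_coeff h) \<le> norm (coeff h 0)"
    using Suc h by auto
  moreover have "lead_coeff g = lead_coeff h" using h by (simp only: lead_coeff_mult) simp
  moreover have "norm (coeff g 0) = norm z * norm (coeff h 0)"
    using h by (simp add: coeff_mult norm_mult)
  moreover have "0 < norm (lead_coeff h)" using \<open>h \<noteq> 0\<close> by simp
  moreover have "1 < norm z" using Suc z by blast
  ultimately have "0 < norm (coeff h 0)" "1 < norm z" "norm (lead_coeff g) \<le> norm (coeff h 0)"
      "norm (coeff g 0) = norm z * norm (coeff h 0)"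
    by auto
  then have "norm (lead_coeff g) < norm (coeff g 0)"
    using mult_strict_right_mono[of 1 "norm z" "norm (coeff h 0)"] by linarith
  then show ?case by simp
qed (simp add: degree_0_id)

text \<open>
  All complex roots lie outside the closed unit disc, so every nonconstant integer factor has
  constant term of absolute value at least 2; only one factor can then be nonconstant.
\<close>

lemma irreducible_if_dominant_prime_coeff_0:
  fixes f :: "int poly"
  assumes deg: "0 < degree f" and prime: "prime (coeff f 0)"
    and dom: "(\<Sum>i=1..degree f. \<bar>coeff f i\<bar>) < coeff f 0"
  shows "irreducible f"
proof -
  let ?C = "of_int :: int \<Rightarrow> complex"
  \<comment> \<open>At a root in the closed unit disc the other terms would have to cancel the
    constant term, which exceeds the sum of their absolute values.\<close>
  have roots: "1 < norm z" if z: "poly (map_poly ?C f) z = 0" for z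
  proof (rule ccontr)
    assume "\<not> 1 < norm z"
    then have z1: "norm z \<le> 1" by simp
    have "0 = (\<Sum>i\<le>degree f. ?C (coeff f i) * z ^ i)"
      using z by (simp add: poly_altdef degree_map_poly coeff_map_poly)
    also have "{..degree f} = insert 0 {1..degree f}" by auto
    finally have "?C (coeff f 0) = - (\<Sum>i=1..degree f. ?C (coeff f i) * z ^ i)"
      by (simp add: eq_neg_iff_add_eq_0)
    then have "real_of_int \<bar>coeff f 0\<bar> = norm (\<Sum>i=1..degree f. ?C (coeff f i) * z ^ i)"
      by (metis norm_minus_cancel norm_of_int of_int_abs)
    also have "\<dots> \<le> (\<Sum>i=1..degree f. norm (?C (coeff f i) * z ^ i))" by (rule norm_sum)
    also have "\<dots> \<le> (\<Sum>i=1..degree f. real_of_int \<bar>coeff f i\<bar>)"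
    proof (rule sum_mono)
      fix i
      have "norm z ^ i \<le> 1" using z1 by (simp add: power_le_one)
      then show "norm (?C (coeff f i) * z ^ i) \<le> real_of_int \<bar>coeff f i\<bar>"
        by (simp add: norm_mult norm_power mult_left_le)
    qed
    also have "\<dots> = real_of_int (\<Sum>i=1..degree f. \<bar>coeff f i\<bar>)" by simp
    also have "\<dots> < real_of_int (coeff f 0)" using dom by (simp only: of_int_less_iff)
    finally show False by simp
  qed
  have unit: "is_unit g" if fgh: "f = g * h" and g0: "\<bar>coeff g 0\<bar> = 1" for g h
  proof -
    have gr: "1 < norm z" if "poly (map_poly ?C g) z = 0" for z
    proof (rule roots)
      have "map_poly ?C f = map_poly ?C g * map_poly ?C h"
        unfolding fgh by (intro poly_eqI) (simp add: coeff_map_poly coeff_mult)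
      then show "poly (map_poly ?C f) z = 0" using that by simp
    qed
    have "g \<noteq> 0" using g0 by auto
    \<comment> \<open>A nonzero integer leading coefficient has norm at least 1, so the strict root
      bound rules out positive degree.\<close>
    then have "1 \<le> norm (?C (lead_coeff g))"
      by (metis norm_of_int of_int_1_le_iff leading_coeff_0_iff zabs_def zero_less_abs_iff int_one_le_iff_zero_less of_int_abs)
    moreover have "norm (?C (coeff g 0)) = 1" using g0 by (metis norm_of_int of_int_1 of_int_abs)
    ultimately have "degree g = 0"
      using norm_lead_coeff_le_coeff_0[of "map_poly ?C g", OF gr]
      by (simp add: coeff_map_poly degree_map_poly)
    then obtain c where "g = [:c:]" by (metis degree_eq_zeroE)
    then show ?thesis using g0 by (auto simp: is_unit_const_poly_iff zdvd1_eq)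
  qed
  show ?thesis
  proof (rule irreducibleI)
    show "f \<noteq> 0" using deg by auto
    show "\<not> is_unit f" using deg by (auto simp: is_unit_poly_iff)
  next
    fix g h assume fgh: "f = g * h"
    then have "coeff f 0 = coeff g 0 * coeff h 0" by (simp add: coeff_mult)
    then have "is_unit (coeff g 0) \<or> is_unit (coeff h 0)"
      using prime by (metis irreducibleD prime_elem_imp_irreducible prime_imp_prime_elem)
    then show "is_unit g \<or> is_unit h"
      using unit[of g h] unit[of h g] fgh by (auto simp: zdvd1_eq mult.commute)
  qed
qed

section \<open>The order on integer polynomials; divisibility and primality in
  \<open>C_ZX\<close>\<close>

lemma degree_less_imp_less_poly:
  fixes f g :: "'a::linordered_idom poly"
  assumes "degree g < degree f" "0 < f"
  shows "g < f"
proof -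
  have "lead_coeff (f - g) = lead_coeff f"
    using assms lead_coeff_add_le[of "- g" f] by simp
  moreover have "f \<noteq> g" using assms by auto
  ultimately show ?thesis using assms by (simp add: poly_less_iff_lead_coeff poly_pos_iff_lead_coeff)
qed

lemma const_poly_less_iff [simp]:
  "[:a:] < [:b:] \<longleftrightarrow> a < (b :: 'a::linordered_idom)"
  by (auto simp: poly_less_iff_lead_coeff)

lemma const_poly_le_iff [simp]:
  "[:a:] \<le> [:b:] \<longleftrightarrow> a \<le> (b :: 'a::linordered_idom)"
  by (meson const_poly_less_iff not_less)

lemma const_poly_pos_iff [simp]:
  "0 < [:b:] \<longleftrightarrow> 0 < (b :: 'a::linordered_idom)"
  by (auto simp: poly_pos_iff_lead_coeff)

text \<open>The order is discrete: positive integer constants are at least 1, and positive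
  nonconstant polynomials exceed every constant.\<close>

lemma int_poly_ge_1:
  fixes x :: "int poly"
  assumes "0 < x"
  shows "1 \<le> x"
proof (cases "degree x = 0")
  case True
  then obtain c where "x = [:c:]" by (metis degree_eq_zeroE)
  then show ?thesis using assms by (auto simp: one_pCons)
next
  case False
  then show ?thesis using degree_less_imp_less_poly[of 1 x] assms by simp
qed

text \<open>The cofactor of a positive element in a positive element is itself positive.\<close>

lemma divides_in_C_ZX_iff:
  assumes "x \<in> C_ZX" "y \<in> C_ZX"
  shows "divides_in C_ZX x y \<longleftrightarrow> x dvd y"
proof
  assume "x dvd y"
  then obtain z where z: "y = x * z" by (auto simp: dvd_def)
  show "divides_in C_ZX x y"
  proof (cases "y = 0")
    case True
    then show ?thesis unfolding divides_in_def by (intro bexI[of _ 0]) (auto simp: C_ZX_def)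
  next
    case False
    then have "0 < x" "0 < x * z" using assms z by (auto simp: C_ZX_def)
    then have "0 < z" by (rule zero_less_mult_pos[rotated])
    then have "z \<in> C_ZX" by (simp add: C_ZX_def)
    then show ?thesis using z unfolding divides_in_def by auto
  qed
qed (auto simp: divides_in_def)

lemma int_poly_gt_1_not_unit:
  fixes x :: "int poly"
  assumes "1 < x"
  shows "\<not> is_unit x"
proof
  assume "is_unit x"
  then obtain c where "x = [:c:]" "is_unit c" by (auto simp: is_unit_poly_iff)
  then show False using assms by (auto simp: one_pCons zdvd1_eq)
qed

text \<open>Absolute values carry a factorization in the ring into \<open>C_ZX\<close> without
  changing divisibility.\<close>

lemma prime_in_C_ZX_iff:
  assumes "x \<in> C_ZX"
  shows "prime_in C_ZX x \<longleftrightarrow> 0 < x \<and> prime_elem x"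
proof
  assume x: "prime_in C_ZX x"
  then have "1 < x" by (simp add: prime_in_def)
  then have "0 < x" using zero_less_one less_trans by blast
  have abs: "\<bar>a\<bar> \<in> C_ZX" for a :: "int poly" by (simp add: C_ZX_def)
  have "prime_elem x"
  proof (rule prime_elemI)
    fix a b assume "x dvd a * b"
    then have "x dvd \<bar>a\<bar> * \<bar>b\<bar>" by (simp flip: abs_mult)
    then have "divides_in C_ZX x (\<bar>a\<bar> * \<bar>b\<bar>)"
      using assms abs by (simp add: divides_in_C_ZX_iff C_ZX_closed)
    then obtain c where "c \<in> C_ZX" "x * c = \<bar>a\<bar> * \<bar>b\<bar>" by (auto simp: divides_in_def)
    then have "divides_in C_ZX x \<bar>a\<bar> \<or> divides_in C_ZX x \<bar>b\<bar>"
      using x abs unfolding prime_in_def by blast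
    then show "x dvd a \<or> x dvd b" using assms abs by (simp add: divides_in_C_ZX_iff)
  qed (use \<open>0 < x\<close> \<open>1 < x\<close> int_poly_gt_1_not_unit in auto)
  then show "0 < x \<and> prime_elem x" using \<open>0 < x\<close> by simp
next
  assume x: "0 < x \<and> prime_elem x"
  then have "1 \<noteq> x" by auto
  then have "1 < x" using x int_poly_ge_1[of x] by (simp only: le_less) auto
  moreover have "divides_in C_ZX x a \<or> divides_in C_ZX x b"
    if "a \<in> C_ZX" "b \<in> C_ZX" "x * c = a * b" for a b c
    using that x assms by (metis divides_in_C_ZX_iff dvd_triv_left prime_elem_dvd_mult_iff)
  ultimately show "prime_in C_ZX x" by (auto simp: prime_in_def)
qed

text \<open>By discreteness, 1 is the only positive unit.\<close>

lemma pos_prime_elem_dvd_imp_eq: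
  fixes x q :: "int poly"
  assumes q: "prime_elem q" "0 < q" and x: "0 < x" "x dvd q"
  shows "x = 1 \<or> x = q"
proof -
  obtain y where y: "q = x * y" using x by (auto simp: dvd_def)
  then have "0 < y" using x q zero_less_mult_pos by blast
  have "is_unit x \<or> is_unit y"
    using q y by (metis irreducibleD prime_elem_imp_irreducible)
  then have "x = 1 \<or> y = 1"
    using int_poly_gt_1_not_unit[of x] int_poly_gt_1_not_unit[of y] int_poly_ge_1[of x] int_poly_ge_1[of y] x \<open>0 < y\<close>
    by (auto simp: le_less)
  then show ?thesis using y by auto
qed

lemma prime_in_C_ZX_D:
  assumes "v \<in> C_ZX" "prime_in C_ZX v"
  shows "prime_elem v" "0 < v" "1 < v"
  using assms prime_in_C_ZX_iff by (auto simp: prime_in_def)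

section \<open>Prime divisors of good elements\<close>

text \<open>Otherwise \<open>q\<^sup>2\<close> witnesses that \<open>m\<close> is not \<open>p\<close>-good.\<close>

lemma prime_dvd_if_good:
  fixes p q m :: "int poly"
  assumes m: "m \<in> C_ZX" and good: "good_in C_ZX p m"
    and q: "prime_elem q" "0 < q" "p < q" "q * q < m"
  shows "q dvd m"
proof (rule ccontr)
  assume ndvd: "\<not> q dvd m"
  have qC: "q \<in> C_ZX" "q * q \<in> C_ZX" using q by (auto simp: C_ZX_def)
  have "1 < q" using q int_poly_ge_1[of q] by (auto simp: le_less)
  then have "1 < q * q" using less_1_mult by blast
  \<comment> \<open>If \<open>q\<close> does not divide \<open>d\<close>, it divides the cofactor;
    cancelling it leaves \<open>d dvd q\<close>.\<close>
  have one_if: "d = 1" if d: "d \<in> C_ZX" "d dvd q * q" "\<not> q dvd d" for d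
  proof -
    have "0 < d" using d q by (auto simp: C_ZX_def)
    obtain e where e: "q * q = d * e" using d by (auto simp: dvd_def)
    then have "q dvd e" using d q by (metis dvd_triv_left prime_elem_dvd_mult_iff)
    then obtain e' where "e = q * e'" by (auto simp: dvd_def)
    then have "q = d * e'" using e q by auto
    then have "d dvd q" by simp
    then show ?thesis using pos_prime_elem_dvd_imp_eq[of q d] q d \<open>0 < d\<close> by auto
  qed
  have "rel_prime_in C_ZX (q * q) m"
    unfolding rel_prime_in_def using one_if ndvd qC m
    by (auto simp: divides_in_C_ZX_iff dest: dvd_trans)
  moreover have "rel_prime_in C_ZX v (q * q)" if v: "v \<in> C_ZX" "prime_in C_ZX v" "v \<le> p" for v
    unfolding rel_prime_in_def
  proof (intro ballI impI)
    fix d assume d: "d \<in> C_ZX" "divides_in C_ZX d v \<and> divides_in C_ZX d (q * q)"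
    have v': "prime_elem v" "0 < v" using v prime_in_C_ZX_D by auto
    \<comment> \<open>Otherwise \<open>q = v\<close>, against \<open>v \<le> p < q\<close>.\<close>
    have "\<not> q dvd v"
      using pos_prime_elem_dvd_imp_eq[of v q] v v' q \<open>1 < q\<close> by auto
    then show "d = 1" using one_if d v qC by (auto simp: divides_in_C_ZX_iff dest: dvd_trans)
  qed
  ultimately have "prime_in C_ZX (q * q)"
    using good qC q \<open>1 < q * q\<close> unfolding good_in_def by blast
  then have "prime_elem (q * q)" using qC prime_in_C_ZX_D by blast
  then show False using q(1)
    by (metis irreducibleD prime_elem_imp_irreducible prime_elem_not_unit)
qed

text \<open>A positive leading coefficient makes \<open>normalize\<close> the identity, so these
  divisors are among the canonical prime factors.\<close>

lemma finite_pos_prime_divisors: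
  fixes m :: "int poly"
  assumes "m \<noteq> 0"
  shows "finite {q. prime_elem q \<and> 0 < q \<and> q dvd m}"
proof (rule finite_subset)
  show "finite (prime_factors m)" by simp
  show "{q. prime_elem q \<and> 0 < q \<and> q dvd m} \<subseteq> prime_factors m"
  proof clarsimp
    fix q assume q: "prime_elem q" "0 < q" "q dvd m"
    then have "unit_factor (lead_coeff q) = 1"
      by (simp add: poly_pos_iff_lead_coeff unit_factor_int_def)
    then have "normalize q = q" by (simp add: normalize_poly_def unit_factor_poly_def flip: one_pCons)
    then have "prime q" using q by (simp add: prime_def)
    then show "q \<in># prime_factorization m" using q assms by (simp add: in_prime_factors_iff)
  qed
qed

section \<open>The case of constant \<open>p\<close>\<close>

lemma prime_elem_int_const:
  "prime q \<Longrightarrow> prime_elem [:int q:]"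
  by (simp add: prime_elem_const_poly_iff)

lemma GSs_at_const:
  assumes p: "degree p = 0" "p \<in> C_ZX"
  shows "\<exists>n\<in>C_ZX. good_in C_ZX p n \<and> \<not> (\<exists>m\<in>C_ZX. n < m \<and> good_in C_ZX p m)"
proof -
  obtain a where a: "p = [:a:]" using p by (metis degree_eq_zeroE)
  define P where "P = nat a"
  have P: "p = [:int P:]" using a p by (auto simp: P_def C_ZX_def)
  define G where "G = {N. good_in C_ZX p [:int N:]}"
  have C: "[:int N:] \<in> C_ZX" for N by (auto simp: C_ZX_def)
  obtain B where B: "\<And>N. (\<forall>q. prime q \<longrightarrow> P < q \<longrightarrow> q\<^sup>2 < N \<longrightarrow> q dvd N) \<Longrightarrow> N \<le> B"
    using bounded_if_small_primes_dvd[of P] by blast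
  have "N \<le> B" if "N \<in> G" for N
  proof (rule B, intro allI impI)
    fix q assume q: "prime q" "P < q" "q\<^sup>2 < N"
    then have "[:int q:] * [:int q:] < [:int N:]"
      by (simp add: power2_eq_square flip: of_nat_mult)
    then have "[:int q:] dvd [:int N:]"
      using q that P prime_gt_0_nat
      by (intro prime_dvd_if_good[OF C]) (auto simp: G_def prime_elem_int_const)
    then show "q dvd N" by simp
  qed
  then have fin: "finite G" by (meson finite_nat_set_iff_bounded_le)
  \<comment> \<open>Goodness of 0 is vacuous, so \<open>G\<close> is nonempty and has a
    maximum.\<close>
  have "0 \<in> G" by (auto simp: G_def good_in_def)
  then have Max: "good_in C_ZX p [:int (Max G):]" using Max_in[OF fin] unfolding G_def by blast
  moreover have False if m: "m \<in> C_ZX" "[:int (Max G):] < m" "good_in C_ZX p m" for m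
  proof (cases "degree m = 0")
    case True
    then obtain b where b: "m = [:b:]" by (metis degree_eq_zeroE)
    then have "int (Max G) < b" using m by simp
    then have "m = [:int (nat b):]" "Max G < nat b" using b by auto
    then have "nat b \<in> G" using m by (simp add: G_def)
    then show False using Max_ge[OF fin] \<open>Max G < nat b\<close> leD by blast
  next
    case False
    then have m0: "0 < m" using m by (auto simp: C_ZX_def)
    \<comment> \<open>A nonconstant \<open>m\<close> exceeds the square of every integer
      prime.\<close>
    have "[:int q:] dvd m" if "prime q" "P < q" for q
      using m P False that m0 prime_gt_0_nat
      by (intro prime_dvd_if_good[of m p]) (auto simp: prime_elem_int_const intro!: degree_less_imp_less_poly)
    then have sub: "(\<lambda>q. [:int q:]) ` {q. prime q \<and> P < q} \<subseteq> {q. prime_elem q \<and> 0 < q \<and> q dvd m}"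
      using prime_gt_0_nat by (auto simp: prime_elem_int_const)
    have inj: "inj_on (\<lambda>q. [:int q:]) {q. prime q \<and> P < q}" by (auto intro: inj_onI)
    have "finite {q::nat. prime q \<and> P < q}"
      by (rule inj_on_finite[OF inj sub finite_pos_prime_divisors]) (use m0 in simp)
    moreover have "{q::nat. prime q} \<subseteq> {q. prime q \<and> P < q} \<union> {..P}" by auto
    ultimately have "finite {q::nat. prime q}" by (meson finite_Un finite_atMost finite_subset)
    then show False using primes_infinite by blast
  qed
  ultimately show ?thesis using C by blast
qed

section \<open>The case of nonconstant \<open>p\<close>\<close>

text \<open>A translation changes only the constant term, which can be made a prime larger than the
  sum of the absolute values of the other coefficients.\<close>

lemma infinite_prime_translates:
  fixes p :: "int poly"
  assumes "0 < degree p"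
  shows "infinite {c::nat. prime_elem (p + [:int c:])}"
proof
  assume "finite {c::nat. prime_elem (p + [:int c:])}"
  then obtain B where B: "\<And>c. prime_elem (p + [:int c:]) \<Longrightarrow> c \<le> B"
    by (auto simp: finite_nat_set_iff_bounded_le)
  define s where "s = (\<Sum>i=1..degree p. \<bar>coeff p i\<bar>)"
  have "s \<ge> 0" by (simp add: s_def sum_nonneg)
  \<comment> \<open>The threshold makes \<open>r\<close> exceed \<open>s\<close> for dominance, and
    makes the shift \<open>r - coeff p 0\<close> exceed \<open>B\<close>.\<close>
  obtain r where r: "prime r" "r > nat (s + \<bar>coeff p 0\<bar> + int B + 1)" using bigger_prime by blast
  define c where "c = nat (int r - coeff p 0)"
  have c: "int c = int r - coeff p 0" "c > B" using r \<open>s \<ge> 0\<close> by (auto simp: c_def)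
  let ?f = "p + [:int c:]"
  have deg: "degree ?f = degree p" using assms by (simp add: degree_add_eq_left)
  have coeff: "coeff ?f i = coeff p i" if "i \<ge> 1" for i
    using that by (simp add: coeff_pCons split: nat.split)
  have coeff0: "coeff ?f 0 = int r" using c by simp
  have "(\<Sum>i=1..degree ?f. \<bar>coeff ?f i\<bar>) = s" unfolding s_def deg by (rule sum.cong) (simp_all only: coeff atLeastAtMost_iff)
  moreover have "s < int r" using r \<open>s \<ge> 0\<close> by linarith
  ultimately have "irreducible ?f"
    using irreducible_if_dominant_prime_coeff_0[of ?f] assms deg coeff0 r by simp
  then have "prime_elem ?f" by (rule irreducible_imp_prime_elem)
  then show False using B c by fastforce
qed

lemma ex_pos_prime_dvd:
  fixes t :: "int poly"
  assumes "1 < t"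
  obtains u w where "prime_elem u" "0 < u" "0 < w" "t = u * w"
proof -
  have "0 < t" using assms zero_less_one less_trans by blast
  then have "t \<noteq> 0" by auto
  then obtain u where u: "prime u" "u dvd t"
    using prime_divisor_exists[of t] int_poly_gt_1_not_unit[OF assms] by auto
  then have "\<bar>u\<bar> dvd t" by simp
  then obtain w where w: "t = \<bar>u\<bar> * w" by (auto simp: dvd_def)
  have "prime_elem \<bar>u\<bar>" using u by (auto simp: abs_if prime_def prime_elem_def)
  moreover have "0 < \<bar>u\<bar>" using u by auto
  ultimately show ?thesis using that w \<open>0 < t\<close> zero_less_mult_pos by blast
qed

text \<open>
  Let \<open>q\<^sub>1 < q\<^sub>2\<close> be the two smallest primes above \<open>p\<close>; they are constant translates of \<open>p\<close>. The
  smallest composite coprime to \<open>q\<^sub>1\<close> and to all primes up to \<open>p\<close> is \<open>q\<^sub>2\<^sup>2\<close>, and the maximal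
  \<open>p\<close>-good element is the largest multiple of \<open>q\<^sub>1\<close> below it.
\<close>

lemma GSs_at_nonconst:
  assumes p: "0 < degree p" "0 < p"
  shows "\<exists>n\<in>C_ZX. good_in C_ZX p n \<and> \<not> (\<exists>m\<in>C_ZX. n < m \<and> good_in C_ZX p m)"
proof -
  let ?q = "\<lambda>c::nat. p + [:int c:]"
  \<comment> \<open>Only shifts \<open>c > 0\<close> count, as \<open>p\<close> itself may be
    prime.\<close>
  define S where "S = {c. 0 < c \<and> prime_elem (?q c)}"
  have "{c. prime_elem (?q c)} \<subseteq> insert 0 S" by (auto simp: S_def)
  then have S: "infinite S" using infinite_prime_translates[OF p(1)] by (meson finite_insert finite_subset)
  define c1 where "c1 = (LEAST c. c \<in> S)"
  have c1: "c1 \<in> S" "\<And>c. c \<in> S \<Longrightarrow> c1 \<le> c"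
    using S unfolding c1_def by (metis LeastI finite.emptyI ex_in_conv, metis Least_le)
  have "\<exists>c. c \<in> S \<and> c1 < c" using S by (meson infinite_nat_iff_unbounded)
  define c2 where "c2 = (LEAST c. c \<in> S \<and> c1 < c)"
  have c2: "c2 \<in> S" "c1 < c2" "\<And>c. c \<in> S \<Longrightarrow> c1 < c \<Longrightarrow> c2 \<le> c"
    using LeastI_ex[OF \<open>\<exists>c. c \<in> S \<and> c1 < c\<close>] unfolding c2_def by (auto intro: Least_le)
  define q1 where "q1 = ?q c1"
  define q2 where "q2 = ?q c2"
  define d where "d = [:int (c2 - c1):]"
  have q2: "q2 = q1 + d" using c2 by (simp add: q1_def q2_def d_def of_nat_diff)
  have deg: "degree (?q c) = degree p" for c using p by (simp add: degree_add_eq_left)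
  have pos: "0 < ?q c" for c using p by (cases "c = 0") (auto intro: add_pos_pos)
  have const: "[:a:] < ?q c" for a c
    by (rule degree_less_imp_less_poly) (simp_all only: p deg pos degree_pCons_0)
  have q1: "prime_elem q1" "0 < q1" "p < q1" "degree q1 = degree p"
    using c1 pos deg by (auto simp: q1_def S_def)
  have q2': "prime_elem q2" "0 < q2" "p < q2" "degree q2 = degree p"
    using c2 pos deg by (auto simp: q2_def S_def)
  have "0 < d" using c2 by (simp add: d_def)
  have dd: "d * d < q1" using const unfolding d_def q1_def by simp
  \<comment> \<open>Completing the square gives \<open>q2 * q2 = n + d * d\<close> with
    \<open>d * d\<close> constant, so \<open>n\<close> lies just below
    \<open>q2 * q2\<close>.\<close>
  define n where "n = q1 * (q1 + 2 * d)"
  have q2_sq: "q2 * q2 = n + d * d" by (simp add: q2 n_def algebra_simps)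
  \<comment> \<open>If \<open>u - p\<close> is constant, minimality of \<open>c1\<close> and
    \<open>c2\<close> applies; otherwise \<open>u\<close> exceeds every constant translate of
    \<open>p\<close>.\<close>
  have next_prime: "q2 \<le> u" if u: "prime_elem u" "p < u" "u \<noteq> q1" for u
  proof (cases "degree (u - p) = 0")
    case True
    then obtain b where b: "u - p = [:b:]" by (metis degree_eq_zeroE)
    moreover have "0 < u - p" using u by simp
    ultimately have "0 < b" by simp
    have u_eq: "u = ?q (nat b)" using b \<open>0 < b\<close> by (simp add: algebra_simps)
    have bS: "nat b \<in> S" using u \<open>0 < b\<close> unfolding u_eq by (simp add: S_def)
    have "nat b \<noteq> c1" using u_eq u by (auto simp: q1_def)
    then have "c2 \<le> nat b" using c1(2)[OF bS] c2(3)[OF bS] by linarith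
    then have "?q c2 \<le> ?q (nat b)" using \<open>0 < b\<close> by (intro add_left_mono) simp
    then show ?thesis unfolding q2_def u_eq .
  next
    case False
    then have "[:int c2:] < u - p"
      using u by (simp add: degree_less_imp_less_poly)
    then have "p + [:int c2:] < u" by (simp only: less_diff_eq add.commute)
    then show ?thesis unfolding q2_def by (rule less_imp_le)
  qed
  have nC: "n \<in> C_ZX" using q1 \<open>0 < d\<close> by (simp add: n_def C_ZX_def)
  have good: "good_in C_ZX p n"
    unfolding good_in_def
  proof (intro ballI impI, elim conjE, rule ccontr)
    fix t assume t: "t \<in> C_ZX" "1 < t" "t < n" "rel_prime_in C_ZX t n"
      "\<forall>v\<in>C_ZX. prime_in C_ZX v \<and> v \<le> p \<longrightarrow> rel_prime_in C_ZX v t" "\<not> prime_in C_ZX t"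
    have "0 < t" using t zero_less_one less_trans by blast
    \<comment> \<open>Coprimality excludes primes up to \<open>p\<close> and also \<open>q1\<close>,
      which divides \<open>n\<close>. A nonprime \<open>t\<close> has two prime factors, hence is at
      least \<open>q2 * q2\<close>.\<close>
    have factor: "q2 \<le> u" if u: "prime_elem u" "0 < u" "u dvd t" for u
    proof (rule next_prime)
      have uC: "u \<in> C_ZX" using u by (simp add: C_ZX_def)
      have "u \<noteq> 1" using u by auto
      show "p < u"
      proof (rule ccontr)
        assume "\<not> p < u"
        then have "rel_prime_in C_ZX u t" using t uC u prime_in_C_ZX_iff by simp
        then show False using u uC t \<open>u \<noteq> 1\<close> by (auto simp: rel_prime_in_def divides_in_C_ZX_iff)
      qed
      show "u \<noteq> q1"
      proof
        assume "u = q1"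
        then have "u dvd n" by (simp add: n_def)
        then show False using u uC t nC \<open>u \<noteq> 1\<close> by (auto simp: rel_prime_in_def divides_in_C_ZX_iff)
      qed
    qed (use u in auto)
    obtain u w where uw: "prime_elem u" "0 < u" "0 < w" "t = u * w" using ex_pos_prime_dvd t by blast
    have "w \<noteq> 1" using uw t prime_in_C_ZX_iff by auto
    then have "1 < w" using int_poly_ge_1[of w] uw by simp
    then obtain u' w' where uw': "prime_elem u'" "0 < u'" "0 < w'" "w = u' * w'"
      using ex_pos_prime_dvd by blast
    have "q2 \<le> u" "q2 \<le> u'" using factor uw uw' by auto
    moreover have "u' \<le> w" using uw' int_poly_ge_1[of w'] by (simp add: mult_le_cancel_left1)
    ultimately have "q2 * q2 \<le> t" using uw q2' by (auto intro!: mult_mono)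
    then have "n + d * d \<le> t" by (simp add: q2_sq)
    moreover have "n < n + d * d" using \<open>0 < d\<close> by simp
    ultimately show False using t(3) by (meson less_le_trans less_asym)
  qed
  have False if m: "m \<in> C_ZX" "n < m" "good_in C_ZX p m" for m
  proof -
    note dvd_m = prime_dvd_if_good[OF m(1,3)]
    have "0 < m" using m nC by (auto simp: C_ZX_def)
    have "q1 * q1 < n" using q1 \<open>0 < d\<close> by (simp add: n_def)
    then have "q1 dvd m" using dvd_m q1 m by auto
    then obtain s where s: "m = q1 * s" by (auto simp: dvd_def)
    then have "q1 + 2 * d < s" using m q1 by (simp add: n_def mult_less_cancel_left_pos)
    \<comment> \<open>Discreteness gains a full \<open>q1\<close>, which exceeds the constant
      \<open>d * d\<close> separating \<open>n\<close> from \<open>q2 * q2\<close>.\<close>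
    then have "q1 + 2 * d + 1 \<le> s" using int_poly_ge_1[of "s - (q1 + 2 * d)"] by (simp add: algebra_simps)
    then have "q1 * (q1 + 2 * d + 1) \<le> m" using q1 s by simp
    then have "n + q1 \<le> m" by (simp add: n_def algebra_simps)
    then have "q2 * q2 < m"
      unfolding q2_sq using add_strict_left_mono[OF dd, of n] by (rule less_le_trans[rotated])
    then have "q2 dvd m" using dvd_m q2' by auto
    moreover have "\<not> q2 dvd q1"
      using pos_prime_elem_dvd_imp_eq[of q1 q2] q1 q2' q2 \<open>0 < d\<close> by auto
    ultimately have "q2 dvd s" using s q2' prime_elem_dvd_mult_iff by blast
    then obtain k where k: "m = q1 * q2 * k" using s by (auto simp: dvd_def)
    have qq: "0 < q1 * q2" using q1 q2' by simp
    then have "0 < k" using k \<open>0 < m\<close> zero_less_mult_pos by blast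
    moreover have "k \<noteq> 1"
    proof
      assume "k = 1"
      moreover have "q1 * q2 \<le> q2 * q2" using q1 q2' q2 \<open>0 < d\<close> by (intro mult_right_mono) auto
      ultimately show False using k \<open>q2 * q2 < m\<close> by simp
    qed
    ultimately have "0 < k - 1" using int_poly_ge_1[of k] by simp
    then have "2 \<le> k" using int_poly_ge_1[of "k - 1"] by (simp add: algebra_simps)
    then have "q1 * q2 * 2 \<le> m" using qq unfolding k by (intro mult_left_mono) auto
    moreover have "q1 * q1 \<le> q1 * q2" using q1 q2 \<open>0 < d\<close> by simp
    ultimately have big: "q1 * q1 + q1 * q1 \<le> m" by (metis add_mono mult_2_right order.trans)
    \<comment> \<open>The square of a translate differs from \<open>q1 * q1\<close> by terms of
      lower degree, which the second copy of \<open>q1 * q1\<close> in \<open>big\<close>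
      absorbs.\<close>
    have "?q c dvd m" if c: "c \<in> S" for c
    proof (rule dvd_m)
      define a where "a = int c - int c1"
      have q: "?q c = q1 + [:a:]" by (simp add: a_def q1_def)
      have "degree (smult (2 * a) q1 + [:a * a:]) \<le> degree p"
        using q1(4) degree_smult_le[of "2 * a" q1] by (intro degree_add_le) auto
      also have "\<dots> < degree (q1 * q1)" using q1 p by (subst degree_mult_eq) auto
      finally have "smult (2 * a) q1 + [:a * a:] < q1 * q1"
        by (rule degree_less_imp_less_poly) (use q1 in simp)
      then have "q1 * q1 + (smult (2 * a) q1 + [:a * a:]) < q1 * q1 + q1 * q1"
        by (rule add_strict_left_mono)
      moreover have "?q c * ?q c = q1 * q1 + (smult (2 * a) q1 + [:a * a:])"
        unfolding q mult_2[of a] smult_add_left by (simp add: smult_add_right distrib_left distrib_right add.assoc)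
      ultimately show "?q c * ?q c < m" using big by (metis less_le_trans)
    qed (use c pos in \<open>auto simp: S_def\<close>)
    then have sub: "?q ` S \<subseteq> {q. prime_elem q \<and> 0 < q \<and> q dvd m}" using pos by (auto simp: S_def)
    have inj: "inj_on ?q S" by (auto intro: inj_onI)
    have "finite S"
      by (rule inj_on_finite[OF inj sub finite_pos_prime_divisors]) (use \<open>0 < m\<close> in simp)
    then show False using S by blast
  qed
  then show ?thesis using nC good by blast
qed

theorem theorem6p1:
  "satisfies_GSs C_ZX"
  unfolding satisfies_GSs_def
proof (intro ballI impI)
  fix p assume p: "p \<in> C_ZX" "prime_in C_ZX p"
  then show "\<exists>n\<in>C_ZX. good_in C_ZX p n \<and> \<not> (\<exists>m\<in>C_ZX. n < m \<and> good_in C_ZX p m)"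
    using GSs_at_const GSs_at_nonconst prime_in_C_ZX_D by (cases "degree p = 0") auto
qed

end
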